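(* Let $\mathbb{F}$ be an ordered field and let $\mathcal{L}=\{L_1,\ldots,L_n\}$ ($n\ge 3$) be a line arrangement in $\mathbb{F}^2$; indices are taken modulo $n$. Suppose that for every $i\in\{1,\ldots,n\}$ the intersection points $L_j\cap L_{j+1}$ with $j\in\{1,\ldots,n\}\setminus\{i-1,i\}$ all lie in one and the same open half-plane bounded by $L_i$. Then the arrangement has an $n$-gonality, i.e. it has global cyclicity.
   Context: An ordered field is a totally ordered field with $x\le y\Rightarrow x+z\le y+z$ and $x,y\ge0\Rightarrow xy\ge0$. A line arrangement is a finite set of lines in $\mathbb{F}^2$ with no two parallel and no three concurrent. If $L_i$ has equation $a_ix+b_iy=c_i$, a region is a set $\{(x,y):\varepsilon_i(a_ix+b_iy-c_i)\ge0\ \forall i\}$ (for some signs $\varepsilon_i$) containing a point where all inequalities are strict; it is bounded if it contains no ray $\{v+tw:t\ge0\}$, $w\ne0$. An $n$-gonality (global cyclicity) is a bounded region $R$ such that every line $L_i$ meets $R$ in a segment $[v_i,w_i]$ whose endpoints are adjacent intersection points of the arrangement on $L_i$ (no other intersection point lies strictly between them). *)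

theory Defs
  imports Main
begin

text \<open>The plane over an ordered field is the type \<^typ>\<open>'a \<times> 'a\<close> with
  \<^class>\<open>linordered_field\<close> elements as coordinates. The field need not be Archimedean
  and \<^typ>\<open>'a \<times> 'a\<close> is not a real vector space, so the library's segments and
  boundedness do not apply.\<close>

definition line_of :: "'a::linordered_field \<Rightarrow> 'a \<Rightarrow> 'a \<Rightarrow> ('a \<times> 'a) set" where
  "line_of a b c = {(x, y). a * x + b * y = c}"

definition line_equation :: "('a::linordered_field \<times> 'a) set \<Rightarrow> 'a \<Rightarrow> 'a \<Rightarrow> 'a \<Rightarrow> bool" where
  "line_equation l a b c \<longleftrightarrow> (a \<noteq> 0 \<or> b \<noteq> 0) \<and> l = line_of a b c"

definition is_line :: "('a::linordered_field \<times> 'a) set \<Rightarrow> bool" where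
  "is_line l \<longleftrightarrow> (\<exists>a b c. line_equation l a b c)"

definition parallel :: "('a::linordered_field \<times> 'a) set \<Rightarrow> ('a \<times> 'a) set \<Rightarrow> bool" where
  "parallel l m \<longleftrightarrow> l = m \<or> l \<inter> m = {}"

definition line_arrangement :: "('a::linordered_field \<times> 'a) set set \<Rightarrow> bool" where
  "line_arrangement A \<longleftrightarrow>
     finite A \<and> (\<forall>l\<in>A. is_line l) \<and>
     (\<forall>l\<in>A. \<forall>m\<in>A. l \<noteq> m \<longrightarrow> \<not> parallel l m) \<and>
     (\<forall>k\<in>A. \<forall>l\<in>A. \<forall>m\<in>A. k \<noteq> l \<and> l \<noteq> m \<and> k \<noteq> m \<longrightarrow> k \<inter> l \<inter> m = {})"

text \<open>Negating \<open>a\<close>, \<open>b\<close> and \<open>c\<close> gives the opposite side, so each line bounds two open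
  half-planes in the following sense.\<close>

definition open_half_plane :: "('a::linordered_field \<times> 'a) set \<Rightarrow> ('a \<times> 'a) set \<Rightarrow> bool" where
  "open_half_plane l H \<longleftrightarrow>
     (\<exists>a b c. line_equation l a b c \<and> H = {(x, y). a * x + b * y > c})"

text \<open>The equation of a line is unique up to a nonzero factor, which only affects the signs
  \<open>e l\<close>; hence it does not matter which equations are chosen.\<close>

definition is_region ::
    "('a::linordered_field \<times> 'a) set set \<Rightarrow> ('a \<times> 'a) set \<Rightarrow> bool" where
  "is_region A R \<longleftrightarrow>
     (\<exists>a b c e. (\<forall>l\<in>A. line_equation l (a l) (b l) (c l) \<and> e l \<in> {1, -1}) \<and>
        R = {(x, y). \<forall>l\<in>A. e l * (a l * x + b l * y - c l) \<ge> 0} \<and>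
        (\<exists>x y. \<forall>l\<in>A. e l * (a l * x + b l * y - c l) > 0))"

definition ray :: "'a::linordered_field \<times> 'a \<Rightarrow> 'a \<times> 'a \<Rightarrow> ('a \<times> 'a) set" where
  "ray v w = {(fst v + t * fst w, snd v + t * snd w) | t. t \<ge> 0}"

definition ray_bounded :: "('a::linordered_field \<times> 'a) set \<Rightarrow> bool" where
  "ray_bounded R \<longleftrightarrow> \<not> (\<exists>v w. w \<noteq> (0, 0) \<and> ray v w \<subseteq> R)"

definition segment :: "'a::linordered_field \<times> 'a \<Rightarrow> 'a \<times> 'a \<Rightarrow> ('a \<times> 'a) set" where
  "segment v w =
     {((1 - t) * fst v + t * fst w, (1 - t) * snd v + t * snd w) | t. 0 \<le> t \<and> t \<le> 1}"

definition intersection_points ::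
    "('a::linordered_field \<times> 'a) set set \<Rightarrow> ('a \<times> 'a) set \<Rightarrow> ('a \<times> 'a) set" where
  "intersection_points A l = {p. \<exists>m\<in>A. m \<noteq> l \<and> p \<in> l \<inter> m}"

definition adjacent_on ::
    "('a::linordered_field \<times> 'a) set set \<Rightarrow> ('a \<times> 'a) set \<Rightarrow> 'a \<times> 'a \<Rightarrow> 'a \<times> 'a \<Rightarrow> bool" where
  "adjacent_on A l v w \<longleftrightarrow>
     v \<in> intersection_points A l \<and> w \<in> intersection_points A l \<and> v \<noteq> w \<and>
     intersection_points A l \<inter> (segment v w - {v, w}) = {}"

text \<open>An \<open>n\<close>-gonality, or global cyclicity, of an arrangement of \<open>n\<close> lines.\<close>

definition is_gonality ::
    "nat \<Rightarrow> ('a::linordered_field \<times> 'a) set set \<Rightarrow> ('a \<times> 'a) set \<Rightarrow> bool" where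
  "is_gonality n A R \<longleftrightarrow>
     card A = n \<and> is_region A R \<and> ray_bounded R \<and>
     (\<forall>l\<in>A. \<exists>v w. l \<inter> R = segment v w \<and> adjacent_on A l v w)"

end

theory Submission
  imports Defs
begin

text \<open>Orient the equation \<open>f\<^sub>i = 0\<close> of the \<open>i\<close>-th line so that \<open>f\<^sub>i\<close> is positive at all the vertices
  \<open>P\<^sub>j = L\<^sub>j \<inter> L\<^sub>j\<^sub>+\<^sub>1\<close> not on the line, and take \<open>R\<close> to be the set where every \<open>f\<^sub>i\<close> is nonnegative.
  It contains all \<open>P\<^sub>j\<close>, and on the \<open>i\<close>-th line the functions \<open>f\<^sub>i\<^sub>-\<^sub>1\<close> and \<open>f\<^sub>i\<^sub>+\<^sub>1\<close> cut out exactly the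
  segment from \<open>P\<^sub>i\<^sub>-\<^sub>1\<close> to \<open>P\<^sub>i\<close>. For boundedness, write \<open>P\<^sub>i - P\<^sub>i\<^sub>-\<^sub>1 = \<lambda>\<^sub>i (-b\<^sub>i, a\<^sub>i)\<close>. The signs of the
  \<open>f\<^sub>i\<close> at the vertices force all \<open>\<lambda>\<^sub>i\<close> to have the same sign, and the edges sum to zero, so
  \<open>\<Sum>\<^sub>i \<lambda>\<^sub>i (a\<^sub>i, b\<^sub>i) = 0\<close>. A direction \<open>w\<close> of a ray in \<open>R\<close> satisfies \<open>a\<^sub>i w\<^sub>1 + b\<^sub>i w\<^sub>2 \<ge> 0\<close> for all
  \<open>i\<close>, so all these values vanish and \<open>w = 0\<close>.\<close>

section \<open>Cyclic indices and planar preliminaries\<close>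

definition cyc_pred :: "nat \<Rightarrow> nat \<Rightarrow> nat" where
  "cyc_pred n i = (i + n - 1) mod n"

lemma cyc_pred_if: "i < n \<Longrightarrow> cyc_pred n i = (if i = 0 then n - 1 else i - 1)"
proof (cases i)
  case (Suc k)
  assume "i < n"
  then show ?thesis
    using Suc by (simp add: cyc_pred_def)
qed (simp add: cyc_pred_def)

lemma cyc_succ_if: "i < n \<Longrightarrow> Suc i mod n = (if i = n - 1 then 0 else Suc i)"
  by auto

text \<open>A full turn leads back to the starting value, so no step can be strict. This takes the
  place of summing the edge contributions to zero.\<close>

lemma cyclically_mono_const:
  fixes d :: "nat \<Rightarrow> 'b::order"
  assumes mono: "\<And>i. i < n \<Longrightarrow> d (cyc_pred n i) \<le> d i" and i: "i < n"
  shows "d (cyc_pred n i) = d i"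
proof -
  have le: "d j \<le> d k" if "j \<le> k" "k < n" for j k
    using that
  proof (induction k rule: dec_induct)
    case (step k)
    then show ?case
      using mono[of "Suc k"] by (auto simp: cyc_pred_if)
  qed simp
  have wrap: "d (n - 1) \<le> d 0"
    using mono[of 0] i by (simp add: cyc_pred_if)
  show ?thesis
  proof (cases "i = 0")
    case True
    then show ?thesis
      using wrap le[of 0 "n - 1"] i by (simp add: cyc_pred_if antisym)
  next
    case False
    have "d i \<le> d (n - 1)" using le i by simp
    also note wrap
    also have "d 0 \<le> d (i - 1)" using le i by simp
    finally show ?thesis
      using mono[OF i] False i by (simp add: cyc_pred_if)
  qed
qed

lemma orthogonal_imp_rotated_multiple:
  fixes a b x y :: "'a::field"
  assumes "a \<noteq> 0 \<or> b \<noteq> 0" "a * x + b * y = 0"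
  obtains t where "x = - t * b" "y = t * a"
proof (cases "a = 0")
  case True
  then show ?thesis using assms that[of "- x / b"] by auto
next
  case False
  then have "x = - (y / a) * b"
    using assms by (simp add: field_simps eq_neg_iff_add_eq_0)
  then show ?thesis using False that[of "y / a"] by simp
qed

text \<open>Isolates the sign pattern of the oriented equations: \<open>P j\<close> is the common
  point of the lines \<open>j\<close> and \<open>j + 1\<close>, so the vertices on line
  \<open>i\<close> are those with index \<open>i\<close> and \<open>cyc_pred n i\<close>.\<close>

locale vertex_cycle =
  fixes n :: nat and a b c :: "nat \<Rightarrow> 'a::linordered_field" and P :: "nat \<Rightarrow> 'a \<times> 'a"
  assumes n3: "n \<ge> 3"
    and on_line: "\<lbrakk>i < n; j < n; j = i \<or> j = cyc_pred n i\<rbrakk> \<Longrightarrow>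
      a i * fst (P j) + b i * snd (P j) - c i = 0"
    and off_line: "\<lbrakk>i < n; j < n; j \<noteq> i; j \<noteq> cyc_pred n i\<rbrakk> \<Longrightarrow>
      a i * fst (P j) + b i * snd (P j) - c i > 0"
begin

definition side :: "nat \<Rightarrow> 'a \<times> 'a \<Rightarrow> 'a" where
  "side i q = a i * fst q + b i * snd q - c i"

definition polygon :: "('a \<times> 'a) set" where
  "polygon = {q. \<forall>i<n. side i q \<ge> 0}"

lemma side_affine:
  "side i ((1 - t) * fst p + t * fst q, (1 - t) * snd p + t * snd q)
     = (1 - t) * side i p + t * side i q"
  by (simp add: side_def algebra_simps)

lemma cyc_pred_less: "i < n \<Longrightarrow> cyc_pred n i < n"
  by (auto simp: cyc_pred_if)

lemma side_vertex_nonneg: "\<lbrakk>i < n; j < n\<rbrakk> \<Longrightarrow> side i (P j) \<ge> 0"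
  using on_line off_line unfolding side_def by (metis order_le_less)

lemma side_vertex_eq_0_iff:
  "\<lbrakk>i < n; j < n\<rbrakk> \<Longrightarrow> side i (P j) = 0 \<longleftrightarrow> j = i \<or> j = cyc_pred n i"
  using on_line off_line unfolding side_def by (metis less_irrefl)

lemma side_own_vertices [simp]:
  "i < n \<Longrightarrow> side i (P i) = 0"
  "i < n \<Longrightarrow> side i (P (cyc_pred n i)) = 0"
  using side_vertex_eq_0_iff cyc_pred_less by simp_all

lemma side_vertex_pos: "\<lbrakk>i < n; j < n; j \<noteq> i; j \<noteq> cyc_pred n i\<rbrakk> \<Longrightarrow> side i (P j) > 0"
  using off_line by (simp add: side_def)

lemma side_next_pos: "i < n \<Longrightarrow> side (cyc_pred n i) (P i) > 0"
  using n3 by (intro side_vertex_pos) (auto simp: cyc_pred_if split: if_splits)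

lemma side_prev_pos: "i < n \<Longrightarrow> side i (P (cyc_pred n (cyc_pred n i))) > 0"
  using n3 by (intro side_vertex_pos) (auto simp: cyc_pred_if split: if_splits)

lemma cyc_pred_surj: "i < n \<Longrightarrow> \<exists>k<n. cyc_pred n k = i"
  using n3 by (intro exI[of _ "(i + 1) mod n"]) (auto simp: cyc_pred_if cyc_succ_if)

text \<open>With zero normal \<open>side i\<close> would be constant, but it vanishes at
  \<open>P i\<close> and is positive two vertices earlier.\<close>

lemma normal_nonzero: "i < n \<Longrightarrow> a i \<noteq> 0 \<or> b i \<noteq> 0"
  using side_vertex_eq_0_iff[of i i] side_prev_pos[of i] by (auto simp: side_def)

lemma vertex_neq_pred: "i < n \<Longrightarrow> P (cyc_pred n i) \<noteq> P i"
  using side_next_pos[of i] side_own_vertices(1)[of "cyc_pred n i"] cyc_pred_less[of i]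
  by (metis less_irrefl)

section \<open>Edges of the polygon\<close>

lemma edge_multipliers:
  obtains u where
    "\<And>i. i < n \<Longrightarrow> fst (P i) - fst (P (cyc_pred n i)) = - u i * b i"
    "\<And>i. i < n \<Longrightarrow> snd (P i) - snd (P (cyc_pred n i)) = u i * a i"
proof -
  have "\<exists>t. fst (P i) - fst (P (cyc_pred n i)) = - t * b i \<and>
      snd (P i) - snd (P (cyc_pred n i)) = t * a i" if i: "i < n" for i
  proof -
    have "side i (P i) = 0" "side i (P (cyc_pred n i)) = 0"
      using i by simp_all
    then have "a i * (fst (P i) - fst (P (cyc_pred n i)))
        + b i * (snd (P i) - snd (P (cyc_pred n i))) = 0"
      by (simp add: side_def algebra_simps)
    then show ?thesis
      using orthogonal_imp_rotated_multiple normal_nonzero[OF i] by metis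
  qed
  then show thesis using that by metis
qed

lemma line_Int_polygon:
  assumes i: "i < n"
  shows "{q. side i q = 0} \<inter> polygon = segment (P (cyc_pred n i)) (P i)" (is "?l = ?r")
proof
  let ?p = "P (cyc_pred n i)" and ?q = "P i"
  note pi = cyc_pred_less[OF i]
  have zero: "side i ?p = 0" "side i ?q = 0"
    using i by simp_all
  show "?r \<subseteq> ?l"
    using i pi zero by (auto simp: segment_def polygon_def side_affine side_vertex_nonneg)
  show "?l \<subseteq> ?r"
  proof
    fix z assume z: "z \<in> ?l"
    have "a i * (fst z - fst ?p) + b i * (snd z - snd ?p) = 0"
      using z zero by (auto simp: side_def algebra_simps)
    then obtain s where s: "fst z - fst ?p = - s * b i" "snd z - snd ?p = s * a i"
      using orthogonal_imp_rotated_multiple normal_nonzero[OF i] by metis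
    obtain u where u: "fst ?q - fst ?p = - u * b i" "snd ?q - snd ?p = u * a i"
      using edge_multipliers i by metis
    have "u \<noteq> 0"
      using u vertex_neq_pred[OF i] by (auto simp: prod_eq_iff)
    define t where "t = s / u"
    have "fst z - fst ?p = t * (fst ?q - fst ?p)" "snd z - snd ?p = t * (snd ?q - snd ?p)"
      unfolding u s t_def using \<open>u \<noteq> 0\<close> by simp_all
    then have zt: "z = ((1 - t) * fst ?p + t * fst ?q, (1 - t) * snd ?p + t * snd ?q)"
      by (auto simp: prod_eq_iff algebra_simps)
    \<comment> \<open>The preceding line passes through \<open>?p\<close>, so its function at
      \<open>z\<close> is \<open>t\<close> times its positive value at \<open>?q\<close>.\<close>
    have "0 \<le> t * side (cyc_pred n i) ?q"
    proof -
      have "side (cyc_pred n i) z \<ge> 0" using z pi by (auto simp: polygon_def)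
      then show ?thesis
        using pi by (simp add: zt side_affine)
    qed
    then have "0 \<le> t" using side_next_pos[OF i] by (simp add: zero_le_mult_iff)
    \<comment> \<open>The following line \<open>k\<close> passes through \<open>?q\<close>; its
      positive value at \<open>?p\<close> bounds \<open>t\<close> from above.\<close>
    obtain k where k: "k < n" "cyc_pred n k = i" using cyc_pred_surj[OF i] by blast
    have "0 \<le> (1 - t) * side k ?p"
    proof -
      have "side k z \<ge> 0" using z k by (auto simp: polygon_def)
      then show ?thesis
        using side_own_vertices(2)[OF k(1)] k(2) by (simp add: zt side_affine)
    qed
    then have "t \<le> 1" using side_prev_pos[OF k(1)] k by (simp add: zero_le_mult_iff)
    with \<open>0 \<le> t\<close> zt show "z \<in> ?r" by (auto simp: segment_def)
  qed
qed

text \<open>As \<open>n \<ge> 3\<close>, no line other than \<open>i\<close> contains both endpoints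
  of edge \<open>i\<close>, so a proper convex combination of the two nonnegative values is
  positive. This yields adjacency of the endpoints.\<close>

lemma side_between_pos:
  assumes i: "i < n" and m: "m < n" "m \<noteq> i"
    and z: "z \<in> segment (P (cyc_pred n i)) (P i) - {P (cyc_pred n i), P i}"
  shows "side m z > 0"
proof -
  let ?p = "P (cyc_pred n i)" and ?q = "P i"
  obtain t where t: "0 \<le> t" "t \<le> 1"
    and zt: "z = ((1 - t) * fst ?p + t * fst ?q, (1 - t) * snd ?p + t * snd ?q)"
    using z by (auto simp: segment_def)
  have "t \<noteq> 0" "t \<noteq> 1" using z zt by auto
  with t have t': "0 < t" "0 < 1 - t" by auto
  note pi = cyc_pred_less[OF i]
  have "\<not> (side m ?p = 0 \<and> side m ?q = 0)"
    using i pi m n3 by (auto simp: side_vertex_eq_0_iff cyc_pred_if split: if_splits)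
  then have "side m ?p > 0 \<or> side m ?q > 0"
    using side_vertex_nonneg[OF m(1) pi] side_vertex_nonneg[OF m(1) i] by auto
  then have "(1 - t) * side m ?p + t * side m ?q > 0"
    using side_vertex_nonneg[OF m(1) pi] side_vertex_nonneg[OF m(1) i] t'
    by (auto intro: add_pos_nonneg add_nonneg_pos)
  then show ?thesis by (simp add: zt side_affine)
qed

lemma interior_point: "\<exists>z. \<forall>i<n. side i z > 0"
proof -
  \<comment> \<open>The centroid of three vertices works because each line contains at most two of
    them.\<close>
  define z where "z = ((fst (P 0) + fst (P 1) + fst (P 2)) / 3, (snd (P 0) + snd (P 1) + snd (P 2)) / 3)"
  have three_z: "3 * fst z = fst (P 0) + fst (P 1) + fst (P 2)"
    "3 * snd z = snd (P 0) + snd (P 1) + snd (P 2)"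
    by (simp_all add: z_def)
  have "side i z > 0" if i: "i < n" for i
  proof -
    have nn: "side i (P 0) \<ge> 0" "side i (P 1) \<ge> 0" "side i (P 2) \<ge> 0"
      using side_vertex_nonneg i n3 by auto
    have "side i (P 0) \<noteq> 0 \<or> side i (P 1) \<noteq> 0 \<or> side i (P 2) \<noteq> 0"
      using i n3 by (auto simp: side_vertex_eq_0_iff)
    then have "side i (P 0) + side i (P 1) + side i (P 2) > 0"
      using nn by linarith
    also have "side i (P 0) + side i (P 1) + side i (P 2)
        = a i * (3 * fst z) + b i * (3 * snd z) - 3 * c i"
      unfolding three_z by (simp add: side_def algebra_simps)
    also have "\<dots> = 3 * side i z"
      by (simp add: side_def algebra_simps)
    finally show ?thesis by simp
  qed
  then show ?thesis by blast
qed

section \<open>Boundedness of the polygon\<close>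

lemma recession_trivial:
  assumes w: "\<And>i. i < n \<Longrightarrow> a i * fst w + b i * snd w \<ge> 0"
  shows "w = (0, 0)"
proof -
  obtain u where
    ux: "\<And>i. i < n \<Longrightarrow> fst (P i) - fst (P (cyc_pred n i)) = - u i * b i" and
    uy: "\<And>i. i < n \<Longrightarrow> snd (P i) - snd (P (cyc_pred n i)) = u i * a i"
    using edge_multipliers by blast
  \<comment> \<open>The determinant of consecutive normals. Both edges at their common vertex have
    multiplier of sign opposite to \<open>D i\<close>, hence of equal sign.\<close>
  define D where "D i = a (cyc_pred n i) * b i - b (cyc_pred n i) * a i" for i
  have edge: "side k (P i) - side k (P (cyc_pred n i)) = u i * (a i * b k - b i * a k)"
    if "i < n" for i k
  proof -
    have "side k (P i) - side k (P (cyc_pred n i)) =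
        a k * (fst (P i) - fst (P (cyc_pred n i))) + b k * (snd (P i) - snd (P (cyc_pred n i)))"
      by (simp add: side_def algebra_simps)
    then show ?thesis using ux uy that by (simp add: algebra_simps)
  qed
  have neg: "u i * D i < 0" "u (cyc_pred n i) * D i < 0" if i: "i < n" for i
  proof -
    note pi = cyc_pred_less[OF i]
    show "u i * D i < 0"
      using edge[OF i, of "cyc_pred n i"] side_next_pos[OF i] i pi
      by (simp add: D_def algebra_simps)
    show "u (cyc_pred n i) * D i < 0"
      using edge[OF pi, of i] side_prev_pos[OF i] i pi
      by (simp add: D_def algebra_simps)
  qed
  have same_sign: "u 0 * u i > 0" if "i < n" for i
    using that
  proof (induction i)
    case 0
    then show ?case using neg[of 0] by (auto simp: mult_less_0_iff zero_less_mult_iff)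
  next
    case (Suc i)
    then show ?case using neg[of "Suc i"]
      by (auto simp: cyc_pred_if mult_less_0_iff zero_less_mult_iff)
  qed
  \<comment> \<open>The cross product of \<open>w\<close> with the vertices; the factor
    \<open>u 0\<close> makes it nondecreasing whichever the common sign of the multipliers
    is.\<close>
  define d where "d i = u 0 * (fst w * snd (P i) - snd w * fst (P i))" for i
  have step: "d i - d (cyc_pred n i) = u 0 * u i * (a i * fst w + b i * snd w)" if "i < n" for i
  proof -
    have "d i - d (cyc_pred n i) = u 0 * (fst w * (snd (P i) - snd (P (cyc_pred n i)))
        - snd w * (fst (P i) - fst (P (cyc_pred n i))))"
      by (simp add: d_def algebra_simps)
    then show ?thesis using ux uy that by (simp add: algebra_simps)
  qed
  have "d (cyc_pred n i) \<le> d i" if "i < n" for i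
  proof -
    have "d i - d (cyc_pred n i) \<ge> 0"
      unfolding step[OF that] using same_sign[OF that] w[OF that]
      by (intro mult_nonneg_nonneg[of "u 0 * u i"]) auto
    then show ?thesis by simp
  qed
  then have const: "d (cyc_pred n i) = d i" if "i < n" for i
    using cyclically_mono_const that by blast
  have w0: "a i * fst w + b i * snd w = 0" if "i < n" for i
    using step[OF that] const[OF that] same_sign[OF that] by auto
  have "a 0 * fst w + b 0 * snd w = 0" "a 1 * fst w + b 1 * snd w = 0"
    using w0 n3 by auto
  then have "(a 0 * b 1 - b 0 * a 1) * fst w = 0" "(a 0 * b 1 - b 0 * a 1) * snd w = 0"
    by algebra+
  moreover have "a 0 * b 1 - b 0 * a 1 \<noteq> 0"
    using neg[of 1] n3 by (auto simp: D_def cyc_pred_if)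
  ultimately show ?thesis by (simp add: prod_eq_iff)
qed

lemma ray_bounded_polygon: "ray_bounded polygon"
  unfolding ray_bounded_def
proof (intro notI, elim exE conjE)
  fix v w :: "'a \<times> 'a"
  assume nz: "w \<noteq> (0, 0)" and sub: "ray v w \<subseteq> polygon"
  have "a i * fst w + b i * snd w \<ge> 0" if i: "i < n" for i
  proof (rule ccontr)
    define g where "g = a i * fst w + b i * snd w"
    assume "\<not> a i * fst w + b i * snd w \<ge> 0"
    then have g: "g < 0" by (simp add: g_def)
    have ray: "side i v + t * g \<ge> 0" if "t \<ge> 0" for t
    proof -
      have "(fst v + t * fst w, snd v + t * snd w) \<in> polygon"
        using sub that by (auto simp: ray_def)
      then show ?thesis using i by (auto simp: polygon_def side_def g_def algebra_simps)
    qed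
    have "side i v \<ge> 0" using ray[of 0] by simp
    \<comment> \<open>The parameter is chosen so that the affine function takes the value
      -1.\<close>
    then show False
      using ray[of "(side i v + 1) / - g"] g
      by (simp add: divide_nonneg_neg)
  qed
  then have "w = (0, 0)" by (rule recession_trivial)
  with nz show False by simp
qed

section \<open>The polygon as a gonality\<close>

lemma is_gonality_polygon:
  assumes inj: "inj_on L {0..<n}" and L: "\<And>i. i < n \<Longrightarrow> line_equation (L i) (a i) (b i) (c i)"
  shows "is_gonality n (L ` {0..<n}) polygon"
  unfolding is_gonality_def
proof (intro conjI ballI)
  have L_eq: "L i = {q. side i q = 0}" if "i < n" for i
    using L[OF that] by (auto simp: line_equation_def line_of_def side_def)
  show "card (L ` {0..<n}) = n" using inj by (simp add: card_image)
  show "ray_bounded polygon" by (rule ray_bounded_polygon)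
  show "is_region (L ` {0..<n}) polygon"
  proof -
    \<comment> \<open>Regions index their equations by lines, so the coefficients are transported
      along the inverse of \<open>L\<close>.\<close>
    define k where "k = the_inv_into {0..<n} L"
    have k: "k (L i) = i" if "i < n" for i
      unfolding k_def using inj that by (simp add: the_inv_into_f_f)
    have inner: "\<exists>x y. \<forall>i\<in>{0..<n}. c i < a i * x + b i * y"
    proof -
      obtain z where "\<forall>i<n. side i z > 0" using interior_point by blast
      then show ?thesis
        by - (rule exI[of _ "fst z"], rule exI[of _ "snd z"], simp add: side_def)
    qed
    show ?thesis
      unfolding is_region_def
      by (rule exI[of _ "a \<circ> k"], rule exI[of _ "b \<circ> k"], rule exI[of _ "c \<circ> k"],
          rule exI[of _ "\<lambda>_. 1"])
        (use inner in \<open>auto simp: k L polygon_def side_def\<close>)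
  qed
  fix l assume "l \<in> L ` {0..<n}"
  then obtain i where i: "i < n" and l: "l = L i" by auto
  let ?p = "P (cyc_pred n i)" and ?q = "P i"
  note pi = cyc_pred_less[OF i]
  have neq: "L k \<noteq> L i" if "k < n" "k \<noteq> i" for k
    using inj i that by (auto simp: inj_on_def)
  \<comment> \<open>The successor \<open>k\<close> supplies the second line through
    \<open>?q\<close>.\<close>
  obtain k where k: "k < n" "cyc_pred n k = i" using cyc_pred_surj[OF i] by blast
  have ne: "cyc_pred n i \<noteq> i" "k \<noteq> i"
    using i k n3 by (auto simp: cyc_pred_if split: if_splits)
  have "?p \<in> intersection_points (L ` {0..<n}) l"
    unfolding intersection_points_def l using i pi neq[OF pi ne(1)]
    by (auto simp: L_eq side_vertex_eq_0_iff)
  moreover have "?q \<in> intersection_points (L ` {0..<n}) l"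
    unfolding intersection_points_def l using i k neq[OF k(1) ne(2)]
    by (auto simp: L_eq side_vertex_eq_0_iff)
  moreover have "intersection_points (L ` {0..<n}) l \<inter> (segment ?p ?q - {?p, ?q}) = {}"
  proof -
    have False if "z \<in> L m" "m < n" "L m \<noteq> L i" "z \<in> segment ?p ?q - {?p, ?q}" for z m
    proof -
      have "m \<noteq> i" using that(3) by auto
      from side_between_pos[OF i that(2) this that(4)] show False
        using that(1,2) by (simp add: L_eq)
    qed
    then show ?thesis unfolding intersection_points_def l by fastforce
  qed
  ultimately have "adjacent_on (L ` {0..<n}) l ?p ?q"
    using vertex_neq_pred[OF i] by (simp add: adjacent_on_def)
  moreover have "l \<inter> polygon = segment ?p ?q"
    using line_Int_polygon[OF i] by (simp add: l L_eq i)
  ultimately show "\<exists>v w. l \<inter> polygon = segment v w \<and> adjacent_on (L ` {0..<n}) l v w"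
    by blast
qed

end

theorem theorem5p3:
  fixes L :: "nat \<Rightarrow> ('a::linordered_field \<times> 'a) set" and n :: nat
  assumes "n \<ge> 3"
    and "inj_on L {0..<n}"
    and "line_arrangement (L ` {0..<n})"
    and "\<And>i. i < n \<Longrightarrow>
           \<exists>H. open_half_plane (L i) H \<and>
             (\<forall>j \<in> {0..<n} - {(i + n - 1) mod n, i}. L j \<inter> L ((j + 1) mod n) \<subseteq> H)"
  shows "\<exists>R. is_gonality n (L ` {0..<n}) R"
proof -
  \<comment> \<open>The equation witnessing the half-plane already carries the required
    orientation.\<close>
  have "\<exists>a b c. line_equation (L i) a b c \<and>
      (\<forall>j \<in> {0..<n} - {cyc_pred n i, i}. L j \<inter> L ((j + 1) mod n) \<subseteq> {(x, y). a * x + b * y > c})"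
    if "i < n" for i
    using assms(4)[OF that] unfolding open_half_plane_def cyc_pred_def by blast
  then obtain a b c where L: "\<And>i. i < n \<Longrightarrow> line_equation (L i) (a i) (b i) (c i)"
    and half: "\<And>i j. \<lbrakk>i < n; j < n; j \<noteq> cyc_pred n i; j \<noteq> i\<rbrakk> \<Longrightarrow>
      L j \<inter> L ((j + 1) mod n) \<subseteq> {(x, y). a i * x + b i * y > c i}"
    by (metis Diff_iff atLeastLessThan_iff insert_iff empty_iff zero_le)
  have "\<exists>p. p \<in> L j \<inter> L ((j + 1) mod n)" if j: "j < n" for j
  proof -
    have s: "(j + 1) mod n < n" "(j + 1) mod n \<noteq> j"
      using j assms(1) by (auto simp: cyc_succ_if)
    then have "L j \<noteq> L ((j + 1) mod n)"
      using assms(2) j by (auto simp: inj_on_def)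
    then have "\<not> parallel (L j) (L ((j + 1) mod n))"
      using assms(3) j s(1) by (auto simp: line_arrangement_def)
    then show ?thesis by (auto simp: parallel_def)
  qed
  then obtain P where P: "\<And>j. j < n \<Longrightarrow> P j \<in> L j \<inter> L ((j + 1) mod n)" by metis
  interpret vertex_cycle n a b c P
  proof
    fix i j assume ij: "i < n" "j < n"
    show "a i * fst (P j) + b i * snd (P j) - c i = 0" if "j = i \<or> j = cyc_pred n i"
    proof -
      have "P j \<in> L i"
        using that
      proof
        assume "j = cyc_pred n i"
        moreover from this have "(j + 1) mod n = i"
          using ij by (auto simp: cyc_pred_if split: if_splits)
        ultimately show ?thesis using P[OF ij(2)] by simp
      qed (use P[OF ij(2)] in simp)
      then show ?thesis using L[OF ij(1)] by (auto simp: line_equation_def line_of_def)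
    qed
    show "a i * fst (P j) + b i * snd (P j) - c i > 0" if "j \<noteq> i" "j \<noteq> cyc_pred n i"
      using half[OF ij that(2,1)] P[OF ij(2)] by (auto simp: case_prod_beta)
  qed (fact assms(1))
  show ?thesis using is_gonality_polygon[OF assms(2) L] by blast
qed

end
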